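(* Let $R$ be an integral domain and let $I$ be a non-zero ideal of $R$. The following conditions are equivalent: \begin{enumerate} \item $I$ is generated by an idempotent pair, i.e. $I=\langle a,b\rangle$ for some idempotent pair $a,b\in R$. \item $I=\langle a,b\rangle=\langle a^2,b\rangle$ for some $a,b\in R$. \item There exists an ideal $J$ of $R$ such that $I$ and $J$ are comaximal and such that $IJ$ is a principal ideal. \end{enumerate} In particular, if one of the equivalent conditions (1), (2), (3) holds, then $I$ is invertible.
   Context: Two elements $a,b$ of an integral domain $R$ form an idempotent pair if either $a(1-a)\in bR$ or $b(1-b)\in aR$. The notation $\langle x_1,\dots,x_n\rangle$ denotes the ideal of $R$ generated by $x_1,\dots,x_n$. Two ideals $I,J$ of $R$ are comaximal if $I+J=R$. *)

theory Defs
  imports "HOL-Algebra.Ideal_Product"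
begin

section \<open>Idempotent pairs and comaximal ideals\<close>

text \<open>Here \<open>PIdl b\<close> is the set of multiples \<open>bR\<close>.\<close>

definition idempotent_pair :: "('a, 'm) ring_scheme \<Rightarrow> 'a \<Rightarrow> 'a \<Rightarrow> bool" where
  "idempotent_pair R a b \<longleftrightarrow> a \<in> carrier R \<and> b \<in> carrier R \<and>
     (a \<otimes>\<^bsub>R\<^esub> (\<one>\<^bsub>R\<^esub> \<ominus>\<^bsub>R\<^esub> a) \<in> PIdl\<^bsub>R\<^esub> b \<or> b \<otimes>\<^bsub>R\<^esub> (\<one>\<^bsub>R\<^esub> \<ominus>\<^bsub>R\<^esub> b) \<in> PIdl\<^bsub>R\<^esub> a)"

definition comaximal :: "('a, 'm) ring_scheme \<Rightarrow> 'a set \<Rightarrow> 'a set \<Rightarrow> bool" where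
  "comaximal R I J \<longleftrightarrow> ideal I R \<and> ideal J R \<and> I <+>\<^bsub>R\<^esub> J = carrier R"


section \<open>The field of fractions of a domain\<close>

text \<open>
  The library's type of fractions is tied to the type class \<open>idom\<close>; this is the same
  construction for a domain given by a carrier set.
\<close>

definition frac_rel :: "('a, 'm) ring_scheme \<Rightarrow> (('a \<times> 'a) \<times> ('a \<times> 'a)) set" where
  "frac_rel R = {((a, b), (c, d)). a \<in> carrier R \<and> b \<in> carrier R - {\<zero>\<^bsub>R\<^esub>} \<and>
     c \<in> carrier R \<and> d \<in> carrier R - {\<zero>\<^bsub>R\<^esub>} \<and> a \<otimes>\<^bsub>R\<^esub> d = c \<otimes>\<^bsub>R\<^esub> b}"

definition frac :: "('a, 'm) ring_scheme \<Rightarrow> 'a \<Rightarrow> 'a \<Rightarrow> ('a \<times> 'a) set" where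
  "frac R a b = frac_rel R `` {(a, b)}"

definition frac_field :: "('a, 'm) ring_scheme \<Rightarrow> ('a \<times> 'a) set ring" where
  "frac_field R =
    \<lparr> carrier = (carrier R \<times> (carrier R - {\<zero>\<^bsub>R\<^esub>})) // frac_rel R,
      mult = (\<lambda>X Y. \<Union>(a, b)\<in>X. \<Union>(c, d)\<in>Y. frac R (a \<otimes>\<^bsub>R\<^esub> c) (b \<otimes>\<^bsub>R\<^esub> d)),
      one = frac R \<one>\<^bsub>R\<^esub> \<one>\<^bsub>R\<^esub>,
      zero = frac R \<zero>\<^bsub>R\<^esub> \<one>\<^bsub>R\<^esub>,
      add = (\<lambda>X Y. \<Union>(a, b)\<in>X. \<Union>(c, d)\<in>Y.
               frac R (a \<otimes>\<^bsub>R\<^esub> d \<oplus>\<^bsub>R\<^esub> c \<otimes>\<^bsub>R\<^esub> b) (b \<otimes>\<^bsub>R\<^esub> d)) \<rparr>"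

definition frac_emb :: "('a, 'm) ring_scheme \<Rightarrow> 'a \<Rightarrow> ('a \<times> 'a) set" where
  "frac_emb R a = frac R a \<one>\<^bsub>R\<^esub>"

context domain
begin

lemma equiv_frac_rel: "equiv (carrier R \<times> (carrier R - {\<zero>})) (frac_rel R)"
proof (rule equivI)
  show "frac_rel R \<subseteq> (carrier R \<times> (carrier R - {\<zero>})) \<times> (carrier R \<times> (carrier R - {\<zero>}))"
    by (auto simp: frac_rel_def)
  show "refl_on (carrier R \<times> (carrier R - {\<zero>})) (frac_rel R)"
    by (auto simp: refl_on_def frac_rel_def)
  show "sym (frac_rel R)"
    by (auto simp: sym_def frac_rel_def)
  show "trans (frac_rel R)"
  proof (rule transI)
    fix x y z assume xy: "(x, y) \<in> frac_rel R" and yz: "(y, z) \<in> frac_rel R"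
    obtain a b c d e f where [simp]: "x = (a, b)" "y = (c, d)" "z = (e, f)"
      by (cases x, cases y, cases z) auto
    have car: "a \<in> carrier R" "b \<in> carrier R" "c \<in> carrier R" "d \<in> carrier R"
        "e \<in> carrier R" "f \<in> carrier R" and nz: "b \<noteq> \<zero>" "d \<noteq> \<zero>" "f \<noteq> \<zero>"
      and 1: "a \<otimes> d = c \<otimes> b" and 2: "c \<otimes> f = e \<otimes> d"
      using xy yz by (auto simp: frac_rel_def)
    have "d \<otimes> (a \<otimes> f) = (a \<otimes> d) \<otimes> f" using car by (simp add: m_ac)
    also have "\<dots> = (c \<otimes> f) \<otimes> b" unfolding 1 using car by (simp add: m_ac)
    also have "\<dots> = d \<otimes> (e \<otimes> b)" unfolding 2 using car by (simp add: m_ac)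
    finally have "a \<otimes> f = e \<otimes> b" using car nz by (simp add: m_lcancel)
    then show "(x, z) \<in> frac_rel R" using car nz by (auto simp: frac_rel_def)
  qed
qed

lemma frac_in_carrier:
  "a \<in> carrier R \<Longrightarrow> b \<in> carrier R \<Longrightarrow> b \<noteq> \<zero> \<Longrightarrow> frac R a b \<in> carrier (frac_field R)"
  by (auto simp: frac_field_def frac_def intro: quotientI)

lemma frac_cases:
  assumes "X \<in> carrier (frac_field R)"
  obtains a b where "a \<in> carrier R" "b \<in> carrier R" "b \<noteq> \<zero>" "X = frac R a b"
  using assms by (auto simp: frac_field_def frac_def elim!: quotientE)

lemma frac_eq_iff:
  assumes "a \<in> carrier R" "b \<in> carrier R" "b \<noteq> \<zero>" "c \<in> carrier R" "d \<in> carrier R" "d \<noteq> \<zero>"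
  shows "frac R a b = frac R c d \<longleftrightarrow> a \<otimes> d = c \<otimes> b"
  using eq_equiv_class_iff[OF equiv_frac_rel, of "(a, b)" "(c, d)"] assms
  by (auto simp: frac_def frac_rel_def)

lemma mem_frac:
  assumes "a \<in> carrier R" "b \<in> carrier R" "b \<noteq> \<zero>"
  shows "(c, d) \<in> frac R a b \<longleftrightarrow> c \<in> carrier R \<and> d \<in> carrier R \<and> d \<noteq> \<zero> \<and> a \<otimes> d = c \<otimes> b"
  using assms by (auto simp: frac_def frac_rel_def)

lemma frac_UN:
  assumes "a \<in> carrier R" "b \<in> carrier R" "b \<noteq> \<zero>" "c \<in> carrier R" "d \<in> carrier R" "d \<noteq> \<zero>"
    and "\<And>a' b' c' d'. (a', b') \<in> frac R a b \<Longrightarrow> (c', d') \<in> frac R c d \<Longrightarrow> F a' b' c' d' = F a b c d"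
  shows "(\<Union>(a, b)\<in>frac R a b. \<Union>(c, d)\<in>frac R c d. F a b c d) = F a b c d"
proof -
  have "(a, b) \<in> frac R a b" "(c, d) \<in> frac R c d"
    using assms(1-6) by (auto simp: mem_frac)
  then show ?thesis using assms(7) by fast
qed

lemma frac_mult:
  assumes "a \<in> carrier R" "b \<in> carrier R" "b \<noteq> \<zero>" "c \<in> carrier R" "d \<in> carrier R" "d \<noteq> \<zero>"
  shows "frac R a b \<otimes>\<^bsub>frac_field R\<^esub> frac R c d = frac R (a \<otimes> c) (b \<otimes> d)"
  unfolding frac_field_def monoid.simps
proof (rule frac_UN[OF assms])
  fix a' b' c' d' assume "(a', b') \<in> frac R a b" "(c', d') \<in> frac R c d"
  then have h: "a' \<in> carrier R" "b' \<in> carrier R" "b' \<noteq> \<zero>" "c' \<in> carrier R" "d' \<in> carrier R"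
      "d' \<noteq> \<zero>" and e: "a \<otimes> b' = a' \<otimes> b" "c \<otimes> d' = c' \<otimes> d"
    using assms by (auto simp: mem_frac)
  have "(a' \<otimes> c') \<otimes> (b \<otimes> d) = (a' \<otimes> b) \<otimes> (c' \<otimes> d)" using assms h by (simp add: m_ac)
  also have "\<dots> = (a \<otimes> c) \<otimes> (b' \<otimes> d')" unfolding e[symmetric] using assms h by (simp add: m_ac)
  finally show "frac R (a' \<otimes> c') (b' \<otimes> d') = frac R (a \<otimes> c) (b \<otimes> d)"
    using assms h by (subst frac_eq_iff) (auto simp: integral_iff)
qed

lemma frac_add:
  assumes "a \<in> carrier R" "b \<in> carrier R" "b \<noteq> \<zero>" "c \<in> carrier R" "d \<in> carrier R" "d \<noteq> \<zero>"
  shows "frac R a b \<oplus>\<^bsub>frac_field R\<^esub> frac R c d = frac R (a \<otimes> d \<oplus> c \<otimes> b) (b \<otimes> d)"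
  unfolding frac_field_def ring.simps
proof (rule frac_UN[OF assms])
  fix a' b' c' d' assume "(a', b') \<in> frac R a b" "(c', d') \<in> frac R c d"
  then have h: "a' \<in> carrier R" "b' \<in> carrier R" "b' \<noteq> \<zero>" "c' \<in> carrier R" "d' \<in> carrier R"
      "d' \<noteq> \<zero>" and e: "a \<otimes> b' = a' \<otimes> b" "c \<otimes> d' = c' \<otimes> d"
    using assms by (auto simp: mem_frac)
  have "(a' \<otimes> d' \<oplus> c' \<otimes> b') \<otimes> (b \<otimes> d) = (a' \<otimes> b) \<otimes> (d' \<otimes> d) \<oplus> (c' \<otimes> d) \<otimes> (b' \<otimes> b)"
    using assms h by (simp add: l_distr r_distr m_ac)
  also have "\<dots> = (a \<otimes> d \<oplus> c \<otimes> b) \<otimes> (b' \<otimes> d')"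
    unfolding e[symmetric] using assms h by (simp add: l_distr r_distr m_ac)
  finally show "frac R (a' \<otimes> d' \<oplus> c' \<otimes> b') (b' \<otimes> d') = frac R (a \<otimes> d \<oplus> c \<otimes> b) (b \<otimes> d)"
    using assms h by (subst frac_eq_iff) (auto simp: integral_iff)
qed

lemma frac_one: "\<one>\<^bsub>frac_field R\<^esub> = frac R \<one> \<one>"
  by (simp add: frac_field_def)

lemma frac_zero: "\<zero>\<^bsub>frac_field R\<^esub> = frac R \<zero> \<one>"
  by (simp add: frac_field_def)

lemmas frac_ops = frac_mult frac_add frac_one frac_zero frac_in_carrier integral_iff

lemma cring_frac_field: "cring (frac_field R)"
proof (rule cringI)
  show "abelian_group (frac_field R)"
  proof (rule abelian_groupI)
    fix x y assume "x \<in> carrier (frac_field R)" "y \<in> carrier (frac_field R)"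
    then show "x \<oplus>\<^bsub>frac_field R\<^esub> y \<in> carrier (frac_field R)"
      by (elim frac_cases) (simp add: frac_ops)
  next
    show "\<zero>\<^bsub>frac_field R\<^esub> \<in> carrier (frac_field R)" by (simp add: frac_ops)
  next
    fix x y z
    assume "x \<in> carrier (frac_field R)" "y \<in> carrier (frac_field R)" "z \<in> carrier (frac_field R)"
    then show "x \<oplus>\<^bsub>frac_field R\<^esub> y \<oplus>\<^bsub>frac_field R\<^esub> z
        = x \<oplus>\<^bsub>frac_field R\<^esub> (y \<oplus>\<^bsub>frac_field R\<^esub> z)"
      by (elim frac_cases) (simp add: frac_ops frac_eq_iff l_distr r_distr m_ac a_ac)
  next
    fix x y assume "x \<in> carrier (frac_field R)" "y \<in> carrier (frac_field R)"
    then show "x \<oplus>\<^bsub>frac_field R\<^esub> y = y \<oplus>\<^bsub>frac_field R\<^esub> x"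
      by (elim frac_cases) (simp add: frac_ops frac_eq_iff m_ac a_ac)
  next
    fix x assume "x \<in> carrier (frac_field R)"
    then show "\<zero>\<^bsub>frac_field R\<^esub> \<oplus>\<^bsub>frac_field R\<^esub> x = x"
      by (elim frac_cases) (simp add: frac_ops)
  next
    fix x assume "x \<in> carrier (frac_field R)"
    then obtain a b where x: "a \<in> carrier R" "b \<in> carrier R" "b \<noteq> \<zero>" "x = frac R a b"
      by (rule frac_cases)
    have "frac R (\<ominus> a) b \<oplus>\<^bsub>frac_field R\<^esub> x = \<zero>\<^bsub>frac_field R\<^esub>"
      using x by (simp add: frac_ops frac_eq_iff l_minus l_neg)
    then show "\<exists>y\<in>carrier (frac_field R). y \<oplus>\<^bsub>frac_field R\<^esub> x = \<zero>\<^bsub>frac_field R\<^esub>"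
      using x by (auto intro: frac_in_carrier)
  qed
  show "comm_monoid (frac_field R)"
  proof (rule comm_monoidI)
    fix x y assume "x \<in> carrier (frac_field R)" "y \<in> carrier (frac_field R)"
    then show "x \<otimes>\<^bsub>frac_field R\<^esub> y \<in> carrier (frac_field R)"
      by (elim frac_cases) (simp add: frac_ops)
  next
    show "\<one>\<^bsub>frac_field R\<^esub> \<in> carrier (frac_field R)" by (simp add: frac_ops)
  next
    fix x y z
    assume "x \<in> carrier (frac_field R)" "y \<in> carrier (frac_field R)" "z \<in> carrier (frac_field R)"
    then show "x \<otimes>\<^bsub>frac_field R\<^esub> y \<otimes>\<^bsub>frac_field R\<^esub> z
        = x \<otimes>\<^bsub>frac_field R\<^esub> (y \<otimes>\<^bsub>frac_field R\<^esub> z)"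
      by (elim frac_cases) (simp add: frac_ops m_ac)
  next
    fix x assume "x \<in> carrier (frac_field R)"
    then show "\<one>\<^bsub>frac_field R\<^esub> \<otimes>\<^bsub>frac_field R\<^esub> x = x"
      by (elim frac_cases) (simp add: frac_ops)
  next
    fix x y assume "x \<in> carrier (frac_field R)" "y \<in> carrier (frac_field R)"
    then show "x \<otimes>\<^bsub>frac_field R\<^esub> y = y \<otimes>\<^bsub>frac_field R\<^esub> x"
      by (elim frac_cases) (simp add: frac_ops m_ac)
  qed
  fix x y z
  assume "x \<in> carrier (frac_field R)" "y \<in> carrier (frac_field R)" "z \<in> carrier (frac_field R)"
  then show "(x \<oplus>\<^bsub>frac_field R\<^esub> y) \<otimes>\<^bsub>frac_field R\<^esub> z
      = x \<otimes>\<^bsub>frac_field R\<^esub> z \<oplus>\<^bsub>frac_field R\<^esub> y \<otimes>\<^bsub>frac_field R\<^esub> z"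
    by (elim frac_cases) (simp add: frac_ops frac_eq_iff l_distr r_distr m_ac)
qed

lemma field_frac_field: "field (frac_field R)"
proof (rule cring.cring_fieldI2[OF cring_frac_field])
  show "\<zero>\<^bsub>frac_field R\<^esub> \<noteq> \<one>\<^bsub>frac_field R\<^esub>"
    by (simp add: frac_ops frac_eq_iff)
next
  fix x assume "x \<in> carrier (frac_field R)" and nz: "x \<noteq> \<zero>\<^bsub>frac_field R\<^esub>"
  then obtain a b where x: "a \<in> carrier R" "b \<in> carrier R" "b \<noteq> \<zero>" "x = frac R a b"
    by (elim frac_cases)
  with nz have a: "a \<noteq> \<zero>" by (auto simp: frac_ops frac_eq_iff)
  then have "x \<otimes>\<^bsub>frac_field R\<^esub> frac R b a = \<one>\<^bsub>frac_field R\<^esub>"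
    using x by (simp add: frac_ops frac_eq_iff m_ac)
  then show "\<exists>y\<in>carrier (frac_field R). x \<otimes>\<^bsub>frac_field R\<^esub> y = \<one>\<^bsub>frac_field R\<^esub>"
    using x a by (auto intro: frac_in_carrier)
qed

lemma frac_emb_hom: "frac_emb R \<in> ring_hom R (frac_field R)"
  by (rule ring_hom_memI) (simp_all add: frac_emb_def frac_ops)

lemma frac_emb_inj: "inj_on (frac_emb R) (carrier R)"
  by (rule inj_onI) (simp add: frac_emb_def frac_eq_iff)

lemma frac_emb_quotient:
  assumes "a \<in> carrier R" "b \<in> carrier R" "b \<noteq> \<zero>"
  shows "frac R a b \<otimes>\<^bsub>frac_field R\<^esub> frac_emb R b = frac_emb R a"
  using assms by (simp add: frac_emb_def frac_ops frac_eq_iff m_ac)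

end


section \<open>Invertible ideals\<close>

definition fractional_ideal :: "('a, 'm) ring_scheme \<Rightarrow> ('a \<times> 'a) set set \<Rightarrow> bool" where
  "fractional_ideal R M \<longleftrightarrow>
     additive_subgroup M (frac_field R) \<and>
     (\<forall>r\<in>carrier R. \<forall>x\<in>M. frac_emb R r \<otimes>\<^bsub>frac_field R\<^esub> x \<in> M) \<and>
     (\<exists>d\<in>carrier R - {\<zero>\<^bsub>R\<^esub>}. \<forall>x\<in>M. frac_emb R d \<otimes>\<^bsub>frac_field R\<^esub> x \<in> frac_emb R ` carrier R)"

text \<open>
  \<^const>\<open>ideal_prod\<close> consists of the finite sums of products for arbitrary subsets of a ring, so,
  taken in the field of fractions, it is the usual product of fractional ideals.
\<close>

definition invertible_ideal :: "('a, 'm) ring_scheme \<Rightarrow> 'a set \<Rightarrow> bool" where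
  "invertible_ideal R I \<longleftrightarrow> ideal I R \<and>
     (\<exists>M. fractional_ideal R M \<and>
        (frac_emb R ` I) \<cdot>\<^bsub>frac_field R\<^esub> M = frac_emb R ` carrier R)"

end

theory Submission
  imports Defs
begin

text \<open>
  If \<open>a = a\<^sup>2r + bs\<close>, then \<open>J = \<langle>1 - ar, b\<rangle>\<close> contains \<open>1 - ar\<close> and is therefore comaximal with
  \<open>I = \<langle>a, b\<rangle>\<close>, while \<open>a (1 - ar) = bs\<close> gives \<open>IJ = bR\<close>. Conversely, if \<open>I + J = R\<close> and
  \<open>IJ = cR\<close>, choose \<open>a \<in> I\<close> with \<open>1 - a \<in> J\<close>; then \<open>a (1 - a) \<in> cR\<close>, and the decomposition
  \<open>x = xa + x (1 - a)\<close> of \<open>x \<in> I\<close> shows \<open>I = \<langle>a, c\<rangle>\<close>. The inverse of \<open>I\<close> is \<open>c\<^sup>-\<^sup>1J\<close> if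
  \<open>c \<noteq> 0\<close>; if \<open>c = 0\<close>, then \<open>J = 0\<close> and \<open>I = R\<close>.
\<close>

lemma (in abelian_group) add_minus_cancel:
  assumes "x \<in> carrier G" "y \<in> carrier G"
  shows "x \<oplus> (y \<ominus> x) = y"
  using assms by (simp add: minus_eq a_lcomm[of x y] r_neg)

section \<open>The three conditions over a commutative ring\<close>

context cring
begin

text \<open>The sum \<open>PIdl a <+> PIdl b\<close> is an ideal containing both generators, so
  minimality of \<open>Idl {a, b}\<close> places \<open>z\<close> in it and yields the
  coefficients.\<close>

lemma mem_genideal_pairE:
  assumes "a \<in> carrier R" "b \<in> carrier R" "z \<in> Idl {a, b}"
  obtains x y where "x \<in> carrier R" "y \<in> carrier R" "z = a \<otimes> x \<oplus> b \<otimes> y"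
proof -
  interpret A: ideal "PIdl a" R using assms(1) by (rule cgenideal_ideal)
  interpret B: ideal "PIdl b" R using assms(2) by (rule cgenideal_ideal)
  have "a = a \<oplus> \<zero>" "b = \<zero> \<oplus> b" using assms by simp_all
  then have "{a, b} \<subseteq> PIdl a <+> PIdl b"
    using cgenideal_self[OF assms(1)] cgenideal_self[OF assms(2)] A.zero_closed B.zero_closed
    unfolding set_add_def' by blast
  then have "z \<in> PIdl a <+> PIdl b"
    using genideal_minimal[OF add_ideals[OF A.is_ideal B.is_ideal]] assms(3) by blast
  then obtain x y where "x \<in> carrier R" "y \<in> carrier R" "z = x \<otimes> a \<oplus> y \<otimes> b"
    unfolding set_add_def' cgenideal_def by blast
  then show ?thesis using assms that by (simp add: m_comm)
qed

text \<open>In \<open>a = a^2 + a (1 - a)\<close> the last summand is a multiple of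
  \<open>b\<close>, which puts \<open>a\<close> into \<open>Idl {a [^] 2, b}\<close>; the other
  inclusion comes from \<open>a^2 = a a\<close>.\<close>

lemma genideal_pair_eq_square:
  assumes "a \<in> carrier R" "b \<in> carrier R" "a \<otimes> (\<one> \<ominus> a) \<in> PIdl b"
  shows "Idl {a, b} = Idl {a [^] (2::nat), b}"
proof
  interpret I: ideal "Idl {a, b}" R using assms by (intro genideal_ideal) auto
  interpret K: ideal "Idl {a [^] (2::nat), b}" R using assms by (intro genideal_ideal) auto
  have mem: "a \<in> Idl {a, b}" "b \<in> Idl {a, b}"
    "a [^] (2::nat) \<in> Idl {a [^] (2::nat), b}" "b \<in> Idl {a [^] (2::nat), b}"
    using genideal_self[of "{a, b}"] genideal_self[of "{a [^] (2::nat), b}"] assms by auto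
  have "a [^] (2::nat) = a \<otimes> a" using assms by (simp add: numeral_2_eq_2)
  then have "a [^] (2::nat) \<in> Idl {a, b}" using mem assms by (simp add: I.I_l_closed)
  then show "Idl {a [^] (2::nat), b} \<subseteq> Idl {a, b}"
    using mem by (intro genideal_minimal I.is_ideal) auto
  have "a \<otimes> (\<one> \<ominus> a) \<in> Idl {a [^] (2::nat), b}"
    using cgenideal_minimal[OF K.is_ideal mem(4)] assms(3) by blast
  moreover have "a = a [^] (2::nat) \<oplus> a \<otimes> (\<one> \<ominus> a)"
    using assms by (simp add: numeral_2_eq_2 add_minus_cancel flip: r_distr)
  ultimately have "a \<in> Idl {a [^] (2::nat), b}" using mem K.a_closed by metis
  then show "Idl {a, b} \<subseteq> Idl {a [^] (2::nat), b}"
    using mem by (intro genideal_minimal K.is_ideal) auto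
qed

text \<open>Idempotent pairs are symmetric in their two elements, whereas the squared form singles
  one out. Hence the fresh witnesses \<open>c\<close>, \<open>d\<close>: they are \<open>a\<close>,
  \<open>b\<close> or, in the second case, \<open>b\<close>, \<open>a\<close>.\<close>

lemma idempotent_pair_imp_square:
  assumes "idempotent_pair R a b"
  shows "\<exists>c\<in>carrier R. \<exists>d\<in>carrier R. Idl {a, b} = Idl {c, d} \<and> Idl {c, d} = Idl {c [^] (2::nat), d}"
proof -
  have car: "a \<in> carrier R" "b \<in> carrier R"
    using assms by (simp_all add: idempotent_pair_def)
  consider "a \<otimes> (\<one> \<ominus> a) \<in> PIdl b" | "b \<otimes> (\<one> \<ominus> b) \<in> PIdl a"
    using assms unfolding idempotent_pair_def by blast
  then show ?thesis
  proof cases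
    case 1
    then show ?thesis
      using car by (intro bexI[of _ a] bexI[of _ b] conjI refl genideal_pair_eq_square)
  next
    case 2
    moreover have "Idl {a, b} = Idl {b, a}" by (simp add: insert_commute)
    ultimately show ?thesis
      using car by (intro bexI[of _ b] bexI[of _ a] conjI genideal_pair_eq_square)
  qed
qed

lemma comaximal_principal_if_square:
  assumes a: "a \<in> carrier R" and b: "b \<in> carrier R"
    and sq: "Idl {a, b} = Idl {a [^] (2::nat), b}"
  shows "\<exists>J. comaximal R (Idl {a, b}) J \<and> principalideal ((Idl {a, b}) \<cdot> J) R"
proof -
  interpret I: ideal "Idl {a, b}" R using a b by (intro genideal_ideal) auto
  have memI: "a \<in> Idl {a, b}" "b \<in> Idl {a, b}" using genideal_self[of "{a, b}"] a b by auto
  have "a \<in> Idl {a [^] (2::nat), b}" using memI(1) sq by simp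
  then obtain r s where r: "r \<in> carrier R" and s: "s \<in> carrier R"
      and e: "a = a [^] (2::nat) \<otimes> r \<oplus> b \<otimes> s"
    using mem_genideal_pairE[OF nat_pow_closed[OF a] b] by blast
  define t where "t = \<one> \<ominus> a \<otimes> r"
  have t: "t \<in> carrier R" using a r by (simp add: t_def)
  have one: "\<one> = a \<otimes> r \<oplus> t"
    using a r by (simp add: t_def add_minus_cancel)
  \<comment> \<open>Two expansions of \<open>a\<close> are compared: multiplying
    \<open>1 = a r + t\<close> by \<open>a\<close> gives \<open>a^2 r + a t\<close>, while
    \<open>e\<close> gives \<open>a^2 r + b s\<close>. Cancelling \<open>a^2 r\<close> leaves the
    claim.\<close>
  have at: "a \<otimes> t = b \<otimes> s"
  proof -
    have "a [^] (2::nat) \<otimes> r \<oplus> a \<otimes> t = a \<otimes> (a \<otimes> r \<oplus> t)"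
      using a r t by (simp add: numeral_2_eq_2 r_distr m_assoc)
    also have "\<dots> = a" using a by (simp flip: one)
    also note e
    finally show ?thesis using a b r s t by simp
  qed
  let ?J = "Idl {t, b}"
  interpret J: ideal ?J R using t b by (intro genideal_ideal) auto
  interpret P: ideal "(Idl {a, b}) \<cdot> ?J" R
    using I.is_ideal J.is_ideal by (rule ideal_prod_is_ideal)
  interpret B: ideal "PIdl b" R using b by (rule cgenideal_ideal)
  have memJ: "t \<in> ?J" "b \<in> ?J" using genideal_self[of "{t, b}"] t b by auto
  have "\<one> \<in> Idl {a, b} <+> ?J"
    using one I.I_r_closed[OF memI(1) r] memJ(1) unfolding set_add_def' by blast
  then have "comaximal R (Idl {a, b}) ?J"
    unfolding comaximal_def
    using ideal.one_imp_carrier[OF add_ideals[OF I.is_ideal J.is_ideal]] I.is_ideal J.is_ideal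
    by blast
  moreover have "(Idl {a, b}) \<cdot> ?J = PIdl b"
  proof
    \<comment> \<open>Multiplying \<open>1 = a r + t\<close> by \<open>b\<close> expresses
      \<open>b\<close> through products of generators: \<open>a b\<close> with \<open>a\<close> in
      the first ideal and \<open>b\<close> in \<open>?J\<close>, and \<open>b t\<close> with
      \<open>b\<close> in the first ideal and \<open>t\<close> in \<open>?J\<close>.\<close>
    have "b = r \<otimes> (a \<otimes> b) \<oplus> b \<otimes> t"
    proof -
      have "b = b \<otimes> (a \<otimes> r \<oplus> t)" using b by (simp flip: one)
      also have "\<dots> = r \<otimes> (a \<otimes> b) \<oplus> b \<otimes> t" using a b r t by (simp add: r_distr m_ac)
      finally show ?thesis .
    qed
    moreover have "r \<otimes> (a \<otimes> b) \<oplus> b \<otimes> t \<in> (Idl {a, b}) \<cdot> ?J"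
      using r memI memJ by (intro P.a_closed P.I_l_closed ideal_prod.prod)
    ultimately show "PIdl b \<subseteq> (Idl {a, b}) \<cdot> ?J" using cgenideal_minimal[OF P.is_ideal] by simp
    show "(Idl {a, b}) \<cdot> ?J \<subseteq> PIdl b"
    proof
      fix z assume "z \<in> (Idl {a, b}) \<cdot> ?J"
      then show "z \<in> PIdl b"
      proof induction
        \<comment> \<open>The only product of generators not visibly divisible by \<open>b\<close>
          is \<open>a t\<close>, and it equals \<open>b s\<close>.\<close>
        case (prod i j)
        obtain x y where x: "x \<in> carrier R" and y: "y \<in> carrier R" and i: "i = a \<otimes> x \<oplus> b \<otimes> y"
          using a b prod(1) by (rule mem_genideal_pairE)
        obtain u v where u: "u \<in> carrier R" and v: "v \<in> carrier R" and j: "j = t \<otimes> u \<oplus> b \<otimes> v"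
          using t b prod(2) by (rule mem_genideal_pairE)
        have jR: "j \<in> carrier R" using prod(2) by (rule J.Icarr)
        have "a \<otimes> x \<otimes> j = (a \<otimes> t) \<otimes> (x \<otimes> u) \<oplus> b \<otimes> (a \<otimes> x \<otimes> v)"
          unfolding j using a b t x u v by (simp add: r_distr m_ac)
        also have "\<dots> = b \<otimes> (s \<otimes> (x \<otimes> u)) \<oplus> b \<otimes> (a \<otimes> x \<otimes> v)"
          unfolding at using b s x u by (simp add: m_assoc)
        finally have "a \<otimes> x \<otimes> j \<in> PIdl b"
          using a s x u v by (simp add: B.I_r_closed[OF cgenideal_self[OF b]])
        moreover have "b \<otimes> y \<otimes> j \<in> PIdl b"
          using y jR by (simp add: B.I_r_closed[OF B.I_r_closed[OF cgenideal_self[OF b]]])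
        ultimately show ?case
          unfolding i using a b x y jR by (simp add: l_distr)
      next
        case (sum z z')
        then show ?case by simp
      qed
    qed
  qed
  ultimately show ?thesis using cgenideal_is_principalideal[OF b] by metis
qed

lemma comaximalE:
  assumes "comaximal R I J"
  obtains a where "a \<in> I" "\<one> \<ominus> a \<in> J"
proof -
  interpret I: ideal I R using assms by (simp add: comaximal_def)
  interpret J: ideal J R using assms by (simp add: comaximal_def)
  have "\<one> \<in> I <+> J" using assms by (simp add: comaximal_def)
  then obtain a j where "a \<in> I" "j \<in> J" and one: "\<one> = a \<oplus> j" unfolding set_add_def' by blast
  moreover have "\<one> \<ominus> a = j"
    using I.Icarr[OF calculation(1)] J.Icarr[OF calculation(2)]
    by (simp add: one minus_eq a_assoc a_lcomm[of a j] r_neg)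
  ultimately show ?thesis using that by blast
qed

lemma idempotent_pair_if_comaximal_principal:
  assumes com: "comaximal R I J" and "principalideal (I \<cdot> J) R"
  shows "\<exists>a\<in>carrier R. \<exists>b\<in>carrier R. idempotent_pair R a b \<and> I = Idl {a, b}"
proof -
  interpret I: ideal I R using com by (simp add: comaximal_def)
  interpret J: ideal J R using com by (simp add: comaximal_def)
  obtain c where c: "c \<in> carrier R" and IJ: "I \<cdot> J = PIdl c"
    using principalideal.generate[OF assms(2)] cgenideal_eq_genideal by metis
  obtain a where a: "a \<in> I" and a': "\<one> \<ominus> a \<in> J" using com by (rule comaximalE)
  interpret K: ideal "Idl {a, c}" R using a c by (intro genideal_ideal) auto
  have memK: "a \<in> Idl {a, c}" "c \<in> Idl {a, c}" using genideal_self[of "{a, c}"] a c by auto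
  \<comment> \<open>\<open>c\<close> lies in \<open>I \<cdot> J\<close>, which is contained in
    \<open>I \<inter> J\<close>.\<close>
  have "c \<in> I"
    using ideal_prod_inter[OF I.is_ideal J.is_ideal] cgenideal_self[OF c] IJ by blast
  then have le: "Idl {a, c} \<subseteq> I" using a by (intro genideal_minimal I.is_ideal) auto
  have "x \<in> Idl {a, c}" if x: "x \<in> I" for x
  proof -
    have "x \<otimes> (\<one> \<ominus> a) \<in> PIdl c" using ideal_prod.prod[OF x a', of R] IJ by simp
    then have "x \<otimes> (\<one> \<ominus> a) \<in> Idl {a, c}"
      using cgenideal_minimal[OF K.is_ideal memK(2)] by blast
    moreover have "x \<otimes> a \<in> Idl {a, c}" using K.I_l_closed[OF memK(1)] x by simp
    ultimately have "x \<otimes> a \<oplus> x \<otimes> (\<one> \<ominus> a) \<in> Idl {a, c}" by (rule K.a_closed[rotated])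
    then show ?thesis using x a by (simp add: add_minus_cancel flip: r_distr)
  qed
  with le have "I = Idl {a, c}" by blast
  \<comment> \<open>The product of \<open>a\<close> in \<open>I\<close> and \<open>1 - a\<close> in
    \<open>J\<close> lies in \<open>I \<cdot> J\<close>, the set of multiples of
    \<open>c\<close>.\<close>
  moreover have "idempotent_pair R a c"
    using ideal_prod.prod[OF a a', of R] a c IJ by (simp add: idempotent_pair_def)
  ultimately show ?thesis using I.Icarr[OF a] c by blast
qed

end

section \<open>Fractions with a common denominator and invertibility\<close>

context domain
begin

lemma frac_add_same_denominator:
  assumes "x \<in> carrier R" "y \<in> carrier R" "c \<in> carrier R" "c \<noteq> \<zero>"
  shows "frac R (x \<oplus> y) c = frac R x c \<oplus>\<^bsub>frac_field R\<^esub> frac R y c"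
  using assms by (simp add: frac_ops frac_eq_iff l_distr r_distr m_ac)

lemma frac_mult_same:
  assumes "x \<in> carrier R" "c \<in> carrier R" "c \<noteq> \<zero>"
  shows "frac R (x \<otimes> c) c = frac_emb R x"
  using assms by (simp add: frac_emb_def frac_eq_iff)

lemma frac_emb_mult_frac:
  assumes "r \<in> carrier R" "x \<in> carrier R" "c \<in> carrier R" "c \<noteq> \<zero>"
  shows "frac_emb R r \<otimes>\<^bsub>frac_field R\<^esub> frac R x c = frac R (r \<otimes> x) c"
  using assms by (simp add: frac_emb_def frac_mult)

text \<open>The set is \<open>c^(-1) J\<close>. It is an additive subgroup as the image of one under
  the group homomorphism from \<open>x\<close> to \<open>x/c\<close>, and \<open>c\<close> itself
  serves as the common denominator.\<close>

lemma fractional_ideal_frac_image: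
  assumes "ideal J R" "c \<in> carrier R" "c \<noteq> \<zero>"
  shows "fractional_ideal R ((\<lambda>x. frac R x c) ` J)"
proof -
  interpret J: ideal J R by fact
  interpret F: cring "frac_field R" by (rule cring_frac_field)
  interpret h: group_hom "add_monoid R" "add_monoid (frac_field R)" "\<lambda>x. frac R x c"
    using assms
    by unfold_locales (auto simp: hom_def frac_in_carrier frac_add_same_denominator)
  have "additive_subgroup ((\<lambda>x. frac R x c) ` J) (frac_field R)"
    using h.subgroup_img_is_subgroup[OF J.a_subgroup] by (rule additive_subgroupI)
  moreover have "frac_emb R r \<otimes>\<^bsub>frac_field R\<^esub> frac R x c \<in> (\<lambda>x. frac R x c) ` J"
    if "r \<in> carrier R" "x \<in> J" for r x
    using that assms by (simp add: frac_emb_mult_frac J.I_l_closed)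
  moreover have "frac_emb R c \<otimes>\<^bsub>frac_field R\<^esub> frac R x c \<in> frac_emb R ` carrier R"
    if "x \<in> J" for x
    using that assms by (simp add: frac_emb_mult_frac frac_mult_same m_comm[of c])
  ultimately show ?thesis unfolding fractional_ideal_def using assms by blast
qed

text \<open>With \<open>M = c^(-1) J\<close> one has
  \<open>I M = c^(-1) (I J) = c^(-1) (c R) = R\<close>, computed in the field of fractions.\<close>

lemma invertible_ideal_if_prod_principal:
  assumes "ideal I R" "ideal J R" and IJ: "I \<cdot> J = PIdl c" and c: "c \<in> carrier R" "c \<noteq> \<zero>"
  shows "invertible_ideal R I"
proof -
  interpret I: ideal I R by fact
  interpret J: ideal J R by fact
  let ?F = "frac_field R" and ?M = "(\<lambda>x. frac R x c) ` J"
  have "frac_emb R ` I \<cdot>\<^bsub>?F\<^esub> ?M = frac_emb R ` carrier R"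
  proof
    show "frac_emb R ` I \<cdot>\<^bsub>?F\<^esub> ?M \<subseteq> frac_emb R ` carrier R"
    proof
      fix z assume "z \<in> frac_emb R ` I \<cdot>\<^bsub>?F\<^esub> ?M"
      then show "z \<in> frac_emb R ` carrier R"
      proof induction
        case (prod u v)
        then obtain i j where ij: "i \<in> I" "j \<in> J" "u = frac_emb R i" "v = frac R j c" by blast
        \<comment> \<open>Since \<open>i j\<close> is a multiple of \<open>c\<close>, the
          denominator cancels: \<open>i (j/c) = (r c)/c = r\<close>.\<close>
        obtain r where r: "r \<in> carrier R" "i \<otimes> j = r \<otimes> c"
          using ideal_prod.prod[OF ij(1,2), of R] IJ unfolding cgenideal_def by blast
        then have "u \<otimes>\<^bsub>?F\<^esub> v = frac_emb R r"
          using ij c by (simp add: frac_emb_mult_frac frac_mult_same)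
        then show ?case using r by simp
      next
        case (sum z z')
        then show ?case by (auto simp flip: ring_hom_add[OF frac_emb_hom])
      qed
    qed
    show "frac_emb R ` carrier R \<subseteq> frac_emb R ` I \<cdot>\<^bsub>?F\<^esub> ?M"
    proof (rule image_subsetI)
      \<comment> \<open>Dividing by \<open>c\<close> carries the finite sums of products in
        \<open>I \<cdot> J\<close> to elements of \<open>I M\<close>. Membership in the carrier is
        part of the induction so that the fraction of a sum can be split.\<close>
      have "x \<in> carrier R \<and> frac R x c \<in> frac_emb R ` I \<cdot>\<^bsub>?F\<^esub> ?M" if "x \<in> I \<cdot> J" for x
        using that
      proof induction
        case (prod i j)
        then have "frac_emb R i \<otimes>\<^bsub>?F\<^esub> frac R j c \<in> frac_emb R ` I \<cdot>\<^bsub>?F\<^esub> ?M"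
          by (intro ideal_prod.prod imageI)
        then show ?case using prod c by (simp add: frac_emb_mult_frac)
      next
        case (sum x y)
        then show ?case using c by (simp add: frac_add_same_denominator ideal_prod.sum)
      qed
      moreover fix r assume r: "r \<in> carrier R"
      then have "r \<otimes> c \<in> I \<cdot> J" unfolding IJ cgenideal_def by blast
      ultimately have "frac R (r \<otimes> c) c \<in> frac_emb R ` I \<cdot>\<^bsub>?F\<^esub> ?M" by blast
      then show "frac_emb R r \<in> frac_emb R ` I \<cdot>\<^bsub>?F\<^esub> ?M"
        using r c by (simp add: frac_mult_same)
    qed
  qed
  then show ?thesis
    unfolding invertible_ideal_def
    using I.is_ideal fractional_ideal_frac_image[OF J.is_ideal c] by blast
qed

lemma invertible_ideal_if_comaximal_principal:
  assumes com: "comaximal R I J" and "principalideal (I \<cdot> J) R" and "I \<noteq> {\<zero>}"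
  shows "invertible_ideal R I"
proof -
  interpret I: ideal I R using com by (simp add: comaximal_def)
  interpret J: ideal J R using com by (simp add: comaximal_def)
  obtain c where c: "c \<in> carrier R" and IJ: "I \<cdot> J = PIdl c"
    using principalideal.generate[OF assms(2)] cgenideal_eq_genideal by metis
  show ?thesis
  proof (cases "c = \<zero>")
    case False
    then show ?thesis
      using invertible_ideal_if_prod_principal[OF I.is_ideal J.is_ideal IJ c] by simp
  next
    case True
    \<comment> \<open>Division by \<open>c\<close> is impossible here. Instead a non-zero
      \<open>x\<close> in \<open>I\<close> satisfies \<open>x (1 - a) = 0\<close>, so
      \<open>a = 1\<close> in the domain and \<open>I\<close> is the whole ring.\<close>
    obtain x where x: "x \<in> I" "x \<noteq> \<zero>" using \<open>I \<noteq> {\<zero>}\<close> I.zero_closed by blast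
    obtain a where a: "a \<in> I" "\<one> \<ominus> a \<in> J" using com by (rule comaximalE)
    have "x \<otimes> (\<one> \<ominus> a) \<in> PIdl \<zero>" using ideal_prod.prod[OF x(1) a(2), of R] IJ True by simp
    then have "x \<otimes> (\<one> \<ominus> a) = \<zero>" by (auto simp: cgenideal_def)
    then have "\<one> \<ominus> a = \<zero>" using x a integral I.Icarr J.Icarr by metis
    then have "\<one> \<in> I" using a add_minus_cancel[of a \<one>] by simp
    then have "I = carrier R" by (rule I.one_imp_carrier)
    moreover have "carrier R = PIdl \<one>" by (simp add: cgenideal_eq_genideal genideal_one)
    \<comment> \<open>The pair \<open>J\<close>, \<open>c\<close> is replaced by the whole ring and
      \<open>1\<close>, so that the product again has a non-zero generator.\<close>
    ultimately have "I \<cdot> carrier R = PIdl \<one>" using ideal_prod_one[OF I.is_ideal] by simp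
    then show ?thesis
      using invertible_ideal_if_prod_principal[OF I.is_ideal oneideal] by simp
  qed
qed

end

theorem theorem1p3:
  fixes R :: "('a, 'm) ring_scheme" (structure) and I :: "'a set"
  assumes "domain R" and "ideal I R" and "I \<noteq> {\<zero>}"
  shows "((\<exists>a\<in>carrier R. \<exists>b\<in>carrier R. idempotent_pair R a b \<and> I = Idl {a, b}) \<longleftrightarrow>
          (\<exists>a\<in>carrier R. \<exists>b\<in>carrier R. I = Idl {a, b} \<and> Idl {a, b} = Idl {a [^] (2::nat), b}))
       \<and> ((\<exists>a\<in>carrier R. \<exists>b\<in>carrier R. I = Idl {a, b} \<and> Idl {a, b} = Idl {a [^] (2::nat), b}) \<longleftrightarrow>
          (\<exists>J. ideal J R \<and> comaximal R I J \<and> principalideal (I \<cdot> J) R))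
       \<and> ((\<exists>a\<in>carrier R. \<exists>b\<in>carrier R. idempotent_pair R a b \<and> I = Idl {a, b}) \<or>
          (\<exists>a\<in>carrier R. \<exists>b\<in>carrier R. I = Idl {a, b} \<and> Idl {a, b} = Idl {a [^] (2::nat), b}) \<or>
          (\<exists>J. ideal J R \<and> comaximal R I J \<and> principalideal (I \<cdot> J) R)
          \<longrightarrow> invertible_ideal R I)"
proof -
  interpret domain R by fact
  let ?P1 = "\<exists>a\<in>carrier R. \<exists>b\<in>carrier R. idempotent_pair R a b \<and> I = Idl {a, b}"
  let ?P2 = "\<exists>a\<in>carrier R. \<exists>b\<in>carrier R. I = Idl {a, b} \<and> Idl {a, b} = Idl {a [^] (2::nat), b}"
  let ?P3 = "\<exists>J. ideal J R \<and> comaximal R I J \<and> principalideal (I \<cdot> J) R"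
  \<comment> \<open>The implications close a cycle through \<open>?P1\<close>, \<open>?P2\<close>,
    \<open>?P3\<close>, so invertibility derived from \<open>?P3\<close> follows from each
    condition.\<close>
  have "?P1 \<Longrightarrow> ?P2" using idempotent_pair_imp_square by metis
  moreover have "?P2 \<Longrightarrow> ?P3" using comaximal_principal_if_square comaximal_def by metis
  moreover have "?P3 \<Longrightarrow> ?P1" using idempotent_pair_if_comaximal_principal by blast
  moreover have "?P3 \<Longrightarrow> invertible_ideal R I"
    using invertible_ideal_if_comaximal_principal \<open>I \<noteq> {\<zero>}\<close> by blast
  ultimately show ?thesis by argo
qed

end
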